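(* Let $M^2: z=z(u,v)$ be a surface in $\mathbb R^4$ without flat points, let $p\in M^2$, and let $g_1, g_2$ be two tangents at $p$ determined by the nonzero tangent vectors $X_1=\lambda_1 z_u+\mu_1 z_v$ and $X_2=\lambda_2 z_u+\mu_2 z_v$. Then $\zeta_{g_1,g_2}=0$ if and only if $$L\lambda_1\lambda_2+M(\lambda_1\mu_2+\lambda_2\mu_1)+N\mu_1\mu_2=0,$$ i.e. $g_1$ and $g_2$ are conjugate in the sense $\zeta_{g_1,g_2}=0$ if and only if they are conjugate with respect to the second fundamental form $II$ of $M^2$.
   Context: $M^2: z=z(u,v)$, $(u,v)\in\mathcal D\subset\mathbb R^2$, is a smooth regular 2-dimensional surface in Euclidean $\mathbb R^4$, with tangent space $T_pM^2=\mathrm{span}\{z_u,z_v\}$. $E,F,G$ are the coefficients of the first fundamental form $I(\lambda,\mu)=E\lambda^2+2F\lambda\mu+G\mu^2$, and $W=\sqrt{EG-F^2}$. $\{e_1,e_2\}$ is an orthonormal normal frame field chosen so that $\{z_u,z_v,e_1,e_2\}$ is positively oriented in $\mathbb R^4$. $\sigma$ is the vector-valued second fundamental tensor (normal part of the second derivative), with $\sigma(z_u,z_u)=c_{11}^1e_1+c_{11}^2e_2$, $\sigma(z_u,z_v)=c_{12}^1e_1+c_{12}^2e_2$, $\sigma(z_v,z_v)=c_{22}^1e_1+c_{22}^2e_2$. The oriented area of the parallelogram of an ordered pair of normal vectors is $S(a^1e_1+a^2e_2,\;b^1e_1+b^2e_2)=a^1b^2-a^2b^1$. Put $L=\frac{2}{W}S(\sigma(z_u,z_u),\sigma(z_u,z_v))$,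 $M=\frac{1}{W}S(\sigma(z_u,z_u),\sigma(z_v,z_v))$, $N=\frac{2}{W}S(\sigma(z_u,z_v),\sigma(z_v,z_v))$. A point is flat if $L=M=N=0$ there. The second fundamental form is $II(\lambda,\mu)=L\lambda^2+2M\lambda\mu+N\mu^2$, with polar form $II(\lambda_1,\mu_1;\lambda_2,\mu_2)=L\lambda_1\lambda_2+M(\lambda_1\mu_2+\lambda_2\mu_1)+N\mu_1\mu_2$; tangents are conjugate with respect to $II$ if the polar form vanishes on them. A tangent $g$ at $p$ is a line through the origin of $T_pM^2$, determined by a nonzero vector $X=\lambda z_u+\mu z_v$. For such $g$ define the linear map $\sigma_g:T_pM^2\to(T_pM^2)^\perp$, $\sigma_g(Y)=\sigma\left(\frac{\lambda z_u+\mu z_v}{\sqrt{I(\lambda,\mu)}},Y\right)$. For two tangents $g_1,g_2$ at $p$ define $$\zeta_{g_1,g_2}=\frac{S(\sigma_{g_1}(z_u),\sigma_{g_2}(z_v))}{W}+\frac{S(\sigma_{g_2}(z_u),\sigma_{g_1}(z_v))}{W}.$$ *)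

theory Defs
  imports "HOL-Analysis.Analysis"
begin

primrec Ck_on :: "nat \<Rightarrow> (real \<times> real) set \<Rightarrow> (real \<times> real \<Rightarrow> 'a::real_normed_vector) \<Rightarrow> bool" where
  "Ck_on 0 D f \<longleftrightarrow> continuous_on D f"
| "Ck_on (Suc k) D f \<longleftrightarrow>
     (\<forall>q\<in>D. f differentiable (at q)) \<and>
     (\<forall>a. Ck_on k D (\<lambda>q. frechet_derivative f (at q) a))"

definition smooth_on :: "(real \<times> real) set \<Rightarrow> (real \<times> real \<Rightarrow> 'a::real_normed_vector) \<Rightarrow> bool" where
  "smooth_on D f \<longleftrightarrow> (\<forall>k. Ck_on k D f)"

definition regular_surface :: "(real \<times> real) set \<Rightarrow> (real \<times> real \<Rightarrow> real^4) \<Rightarrow> bool" where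
  "regular_surface D z \<longleftrightarrow>
     open D \<and> smooth_on D z \<and> (\<forall>q\<in>D. inj (frechet_derivative z (at q)))"

definition partial_u :: "(real \<times> real \<Rightarrow> real^4) \<Rightarrow> real \<times> real \<Rightarrow> real^4" where
  "partial_u z p = frechet_derivative z (at p) (1, 0)"

definition partial_v :: "(real \<times> real \<Rightarrow> real^4) \<Rightarrow> real \<times> real \<Rightarrow> real^4" where
  "partial_v z p = frechet_derivative z (at p) (0, 1)"

definition tangent_space :: "(real \<times> real \<Rightarrow> real^4) \<Rightarrow> real \<times> real \<Rightarrow> (real^4) set" where
  "tangent_space z p = span {partial_u z p, partial_v z p}"

definition normal_space :: "(real \<times> real \<Rightarrow> real^4) \<Rightarrow> real \<times> real \<Rightarrow> (real^4) set" where
  "normal_space z p = orthogonal_comp (tangent_space z p)"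

definition coeff_E :: "(real \<times> real \<Rightarrow> real^4) \<Rightarrow> real \<times> real \<Rightarrow> real" where
  "coeff_E z p = partial_u z p \<bullet> partial_u z p"

definition coeff_F :: "(real \<times> real \<Rightarrow> real^4) \<Rightarrow> real \<times> real \<Rightarrow> real" where
  "coeff_F z p = partial_u z p \<bullet> partial_v z p"

definition coeff_G :: "(real \<times> real \<Rightarrow> real^4) \<Rightarrow> real \<times> real \<Rightarrow> real" where
  "coeff_G z p = partial_v z p \<bullet> partial_v z p"

definition coeff_W :: "(real \<times> real \<Rightarrow> real^4) \<Rightarrow> real \<times> real \<Rightarrow> real" where
  "coeff_W z p = sqrt (coeff_E z p * coeff_G z p - (coeff_F z p)\<^sup>2)"

definition first_form :: "(real \<times> real \<Rightarrow> real^4) \<Rightarrow> real \<times> real \<Rightarrow> real \<Rightarrow> real \<Rightarrow> real" where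
  "first_form z p l m = coeff_E z p * l\<^sup>2 + 2 * coeff_F z p * l * m + coeff_G z p * m\<^sup>2"

definition oriented_normal_frame ::
  "(real \<times> real) set \<Rightarrow> (real \<times> real \<Rightarrow> real^4) \<Rightarrow>
   (real \<times> real \<Rightarrow> real^4) \<Rightarrow> (real \<times> real \<Rightarrow> real^4) \<Rightarrow> bool" where
  "oriented_normal_frame D z e1 e2 \<longleftrightarrow>
     smooth_on D e1 \<and> smooth_on D e2 \<and>
     (\<forall>q\<in>D. e1 q \<in> normal_space z q \<and> e2 q \<in> normal_space z q \<and>
            norm (e1 q) = 1 \<and> norm (e2 q) = 1 \<and> e1 q \<bullet> e2 q = 0 \<and>
            det (vector [partial_u z q, partial_v z q, e1 q, e2 q] :: real^4^4) > 0)"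

definition normal_part :: "(real \<times> real \<Rightarrow> real^4) \<Rightarrow> real \<times> real \<Rightarrow> real^4 \<Rightarrow> real^4" where
  "normal_part z p x = (THE n. n \<in> normal_space z p \<and> x - n \<in> tangent_space z p)"

definition second_derivative ::
  "(real \<times> real \<Rightarrow> real^4) \<Rightarrow> real \<times> real \<Rightarrow> real \<times> real \<Rightarrow> real \<times> real \<Rightarrow> real^4" where
  "second_derivative z p a b =
     frechet_derivative (\<lambda>q. frechet_derivative z (at q) b) (at p) a"

text \<open>The arguments of the tensor are vectors of the tangent space, a subspace of the ambient
  space; the inverse of the (injective) differential recovers their parameter coordinates.\<close>

definition sigma ::
  "(real \<times> real \<Rightarrow> real^4) \<Rightarrow> real \<times> real \<Rightarrow> real^4 \<Rightarrow> real^4 \<Rightarrow> real^4" where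
  "sigma z p X Y =
     normal_part z p
       (second_derivative z p (inv (frechet_derivative z (at p)) X)
                              (inv (frechet_derivative z (at p)) Y))"

text \<open>For an orthonormal frame the coordinates of a normal vector are its inner products with
  the frame vectors; see \<open>oriented_area_coords\<close>.\<close>

definition oriented_area :: "real^4 \<Rightarrow> real^4 \<Rightarrow> real^4 \<Rightarrow> real^4 \<Rightarrow> real" where
  "oriented_area n1 n2 x y = (x \<bullet> n1) * (y \<bullet> n2) - (x \<bullet> n2) * (y \<bullet> n1)"

lemma oriented_area_coords:
  assumes "norm n1 = 1" "norm n2 = 1" "n1 \<bullet> n2 = 0"
  shows "oriented_area n1 n2 (a1 *\<^sub>R n1 + a2 *\<^sub>R n2) (b1 *\<^sub>R n1 + b2 *\<^sub>R n2) = a1 * b2 - a2 * b1"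
  using assms
  by (simp add: oriented_area_def inner_add_left inner_commute[of n2 n1] norm_eq_1)

definition coeff_L ::
  "(real \<times> real \<Rightarrow> real^4) \<Rightarrow> (real \<times> real \<Rightarrow> real^4) \<Rightarrow> (real \<times> real \<Rightarrow> real^4) \<Rightarrow>
   real \<times> real \<Rightarrow> real" where
  "coeff_L z e1 e2 p = 2 / coeff_W z p *
     oriented_area (e1 p) (e2 p)
       (sigma z p (partial_u z p) (partial_u z p)) (sigma z p (partial_u z p) (partial_v z p))"

definition coeff_M ::
  "(real \<times> real \<Rightarrow> real^4) \<Rightarrow> (real \<times> real \<Rightarrow> real^4) \<Rightarrow> (real \<times> real \<Rightarrow> real^4) \<Rightarrow>
   real \<times> real \<Rightarrow> real" where
  "coeff_M z e1 e2 p = 1 / coeff_W z p *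
     oriented_area (e1 p) (e2 p)
       (sigma z p (partial_u z p) (partial_u z p)) (sigma z p (partial_v z p) (partial_v z p))"

definition coeff_N ::
  "(real \<times> real \<Rightarrow> real^4) \<Rightarrow> (real \<times> real \<Rightarrow> real^4) \<Rightarrow> (real \<times> real \<Rightarrow> real^4) \<Rightarrow>
   real \<times> real \<Rightarrow> real" where
  "coeff_N z e1 e2 p = 2 / coeff_W z p *
     oriented_area (e1 p) (e2 p)
       (sigma z p (partial_u z p) (partial_v z p)) (sigma z p (partial_v z p) (partial_v z p))"

definition flat_point ::
  "(real \<times> real \<Rightarrow> real^4) \<Rightarrow> (real \<times> real \<Rightarrow> real^4) \<Rightarrow> (real \<times> real \<Rightarrow> real^4) \<Rightarrow>
   real \<times> real \<Rightarrow> bool" where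
  "flat_point z e1 e2 p \<longleftrightarrow>
     coeff_L z e1 e2 p = 0 \<and> coeff_M z e1 e2 p = 0 \<and> coeff_N z e1 e2 p = 0"

definition second_form_polar ::
  "(real \<times> real \<Rightarrow> real^4) \<Rightarrow> (real \<times> real \<Rightarrow> real^4) \<Rightarrow> (real \<times> real \<Rightarrow> real^4) \<Rightarrow>
   real \<times> real \<Rightarrow> real \<Rightarrow> real \<Rightarrow> real \<Rightarrow> real \<Rightarrow> real" where
  "second_form_polar z e1 e2 p l1 m1 l2 m2 =
     coeff_L z e1 e2 p * l1 * l2 + coeff_M z e1 e2 p * (l1 * m2 + m1 * l2)
     + coeff_N z e1 e2 p * m1 * m2"

definition tangent_vector ::
  "(real \<times> real \<Rightarrow> real^4) \<Rightarrow> real \<times> real \<Rightarrow> real \<Rightarrow> real \<Rightarrow> real^4" where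
  "tangent_vector z p l m = l *\<^sub>R partial_u z p + m *\<^sub>R partial_v z p"

definition tangent_determined_by ::
  "(real \<times> real \<Rightarrow> real^4) \<Rightarrow> real \<times> real \<Rightarrow> (real^4) set \<Rightarrow> real \<Rightarrow> real \<Rightarrow> bool" where
  "tangent_determined_by z p g l m \<longleftrightarrow>
     tangent_vector z p l m \<noteq> 0 \<and> g = span {tangent_vector z p l m}"

text \<open>A tangent \<open>g\<close> fixes its unit direction, hence the map \<open>\<sigma>\<^sub>g\<close> and the number
  \<open>\<zeta>\<close>, only up to sign. Both are therefore functions of the coordinates of
  determining vectors, and conjugacy of lines quantifies over these vectors.\<close>

definition sigma_tangent ::
  "(real \<times> real \<Rightarrow> real^4) \<Rightarrow> real \<times> real \<Rightarrow> real \<Rightarrow> real \<Rightarrow> real^4 \<Rightarrow> real^4" where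
  "sigma_tangent z p l m Y =
     sigma z p ((1 / sqrt (first_form z p l m)) *\<^sub>R tangent_vector z p l m) Y"

definition zeta ::
  "(real \<times> real \<Rightarrow> real^4) \<Rightarrow> (real \<times> real \<Rightarrow> real^4) \<Rightarrow> (real \<times> real \<Rightarrow> real^4) \<Rightarrow>
   real \<times> real \<Rightarrow> real \<Rightarrow> real \<Rightarrow> real \<Rightarrow> real \<Rightarrow> real" where
  "zeta z e1 e2 p l1 m1 l2 m2 =
     oriented_area (e1 p) (e2 p)
       (sigma_tangent z p l1 m1 (partial_u z p)) (sigma_tangent z p l2 m2 (partial_v z p))
       / coeff_W z p
     + oriented_area (e1 p) (e2 p)
       (sigma_tangent z p l2 m2 (partial_u z p)) (sigma_tangent z p l1 m1 (partial_v z p))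
       / coeff_W z p"

definition zeta_conjugate ::
  "(real \<times> real \<Rightarrow> real^4) \<Rightarrow> (real \<times> real \<Rightarrow> real^4) \<Rightarrow> (real \<times> real \<Rightarrow> real^4) \<Rightarrow>
   real \<times> real \<Rightarrow> (real^4) set \<Rightarrow> (real^4) set \<Rightarrow> bool" where
  "zeta_conjugate z e1 e2 p g1 g2 \<longleftrightarrow>
     (\<forall>l1 m1 l2 m2. tangent_determined_by z p g1 l1 m1 \<longrightarrow> tangent_determined_by z p g2 l2 m2 \<longrightarrow>
        zeta z e1 e2 p l1 m1 l2 m2 = 0)"

definition second_form_conjugate ::
  "(real \<times> real \<Rightarrow> real^4) \<Rightarrow> (real \<times> real \<Rightarrow> real^4) \<Rightarrow> (real \<times> real \<Rightarrow> real^4) \<Rightarrow>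
   real \<times> real \<Rightarrow> (real^4) set \<Rightarrow> (real^4) set \<Rightarrow> bool" where
  "second_form_conjugate z e1 e2 p g1 g2 \<longleftrightarrow>
     (\<forall>l1 m1 l2 m2. tangent_determined_by z p g1 l1 m1 \<longrightarrow> tangent_determined_by z p g2 l2 m2 \<longrightarrow>
        second_form_polar z e1 e2 p l1 m1 l2 m2 = 0)"

end

theory Submission
  imports Defs
begin

text \<open>
  Write \<open>I\<^sub>j\<close> for the value of the first fundamental form on \<open>(\<lambda>\<^sub>j, \<mu>\<^sub>j)\<close>. Since \<open>\<sigma>\<close> is bilinear
  and symmetric,
  \<open>\<sigma>\<^sub>g\<^sub>1(z\<^sub>u) = (\<lambda>\<^sub>1 \<sigma>(z\<^sub>u,z\<^sub>u) + \<mu>\<^sub>1 \<sigma>(z\<^sub>u,z\<^sub>v)) / \<surd>I\<^sub>1\<close> and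
  \<open>\<sigma>\<^sub>g\<^sub>2(z\<^sub>v) = (\<lambda>\<^sub>2 \<sigma>(z\<^sub>u,z\<^sub>v) + \<mu>\<^sub>2 \<sigma>(z\<^sub>v,z\<^sub>v)) / \<surd>I\<^sub>2\<close>.
  Expanding the oriented areas in \<open>\<zeta>\<close>, the term \<open>S(\<sigma>(z\<^sub>u,z\<^sub>v), \<sigma>(z\<^sub>u,z\<^sub>v))\<close> vanishes because \<open>S\<close>
  alternates, and the remaining terms are exactly those of the polar form of \<open>II\<close>. This gives
  the identity \<open>\<zeta> = II(\<lambda>\<^sub>1,\<mu>\<^sub>1;\<lambda>\<^sub>2,\<mu>\<^sub>2) / (\<surd>I\<^sub>1 \<surd>I\<^sub>2)\<close> of lemma \<open>zeta_eq_polar\<close>, and \<open>I\<^sub>1\<close>, \<open>I\<^sub>2\<close>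
  are nonzero, being squared lengths of nonzero vectors. As the equivalence holds for every pair
  of vectors determining the two tangents, it passes to conjugacy of the lines themselves.

  The symmetry of \<open>\<sigma>\<close> is that of second derivatives, obtained in \<open>second_derivative_commute\<close>
  from the limit of a second difference quotient. Normal projections never have to be computed:
  \<open>S\<close> sees its arguments only through inner products with the frame, and those are not changed
  by the projection (\<open>inner_normal_part\<close>).
\<close>

section \<open>Symmetry of second derivatives\<close>

text \<open>The mean value inequality in the direction \<open>a\<close> turns the second difference into a first
  difference of the derivative along \<open>a\<close>, to which differentiability at the single point \<open>p\<close>
  applies. The quotient is symmetric in \<open>a\<close> and \<open>b\<close>, while its limit is an iterated
  derivative in a prescribed order.\<close>

lemma second_difference_tendsto:
  fixes f :: "'a::real_normed_vector \<Rightarrow> 'b::real_normed_vector"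
  assumes diff: "\<forall>\<^sub>F q in nhds p. f differentiable (at q)"
    and A: "((\<lambda>q. frechet_derivative f (at q) a) has_derivative A) (at p)"
  shows "((\<lambda>t. (f (p + t *\<^sub>R a + t *\<^sub>R b) - f (p + t *\<^sub>R a) - f (p + t *\<^sub>R b) + f p) /\<^sub>R t\<^sup>2)
           \<longlongrightarrow> A b) (at_right 0)"
proof (rule tendstoI)
  fix \<epsilon> :: real
  assume "\<epsilon> > 0"
  \<comment> \<open>The final error is at most \<open>2 e c = \<epsilon> / 2\<close>; the 1 in \<open>c\<close> only keeps it positive.\<close>
  define c where "c = norm a + norm b + 1"
  define e where "e = \<epsilon> / (4 * c)"
  have c: "c > 0"
    by (simp add: c_def add_nonneg_pos)
  have e: "e > 0"
    using \<open>\<epsilon> > 0\<close> c by (simp add: e_def)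
  let ?h = "\<lambda>q. frechet_derivative f (at q) a"
  interpret A: bounded_linear A
    using A by (rule has_derivative_bounded_linear)
  obtain d1 where d1: "d1 > 0" "\<And>q. dist q p < d1 \<Longrightarrow> f differentiable (at q)"
    using diff by (auto simp: eventually_nhds_metric)
  obtain d2 where d2: "d2 > 0"
      "\<And>q. norm (q - p) < d2 \<Longrightarrow> norm (?h q - ?h p - A (q - p)) \<le> e * norm (q - p)"
    using A e unfolding has_derivative_at_alt by blast
  define d where "d = min d1 d2 / c"
  have d: "d > 0"
    using d1(1) d2(1) c by (simp add: d_def)
  have bound: "dist ((f (p + t *\<^sub>R a + t *\<^sub>R b) - f (p + t *\<^sub>R a) - f (p + t *\<^sub>R b) + f p) /\<^sub>R t\<^sup>2)
                 (A b) < \<epsilon>" if t: "0 < t" "t < d" for t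
  proof -
    have tc: "t * c < d1" "t * c < d2"
      using t c by (auto simp: d_def field_simps)
    have small: "norm (s *\<^sub>R a + r *\<^sub>R b) \<le> t * c" if "0 \<le> s" "s \<le> t" "0 \<le> r" "r \<le> t" for s r
    proof -
      have "norm (s *\<^sub>R a + r *\<^sub>R b) \<le> s * norm a + r * norm b"
        using that by (metis norm_triangle_ineq norm_scaleR abs_of_nonneg)
      also have "\<dots> \<le> t * norm a + t * norm b"
        using that by (intro add_mono mult_right_mono) auto
      also have "\<dots> \<le> t * c"
        using t by (simp add: c_def algebra_simps)
      finally show ?thesis .
    qed
    have est: "norm (?h (p + s *\<^sub>R a + r *\<^sub>R b) - ?h p - A (s *\<^sub>R a + r *\<^sub>R b)) \<le> e * (t * c)"
      if "0 \<le> s" "s \<le> t" "0 \<le> r" "r \<le> t" for s r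
    proof -
      have "norm (?h (p + s *\<^sub>R a + r *\<^sub>R b) - ?h p - A (s *\<^sub>R a + r *\<^sub>R b))
              \<le> e * norm (s *\<^sub>R a + r *\<^sub>R b)"
        using d2(2)[of "p + s *\<^sub>R a + r *\<^sub>R b"] small[OF that] tc by (simp add: add.assoc)
      also have "\<dots> \<le> e * (t * c)"
        using small[OF that] e by simp
      finally show ?thesis .
    qed
    have der: "((\<lambda>s. f (p + s *\<^sub>R a + r *\<^sub>R b)) has_derivative
                 (\<lambda>x. x *\<^sub>R ?h (p + s *\<^sub>R a + r *\<^sub>R b))) (at s within {0..t})"
      if "0 \<le> s" "s \<le> t" "0 \<le> r" "r \<le> t" for s r
    proof -
      let ?q = "p + s *\<^sub>R a + r *\<^sub>R b"
      have "f differentiable (at ?q)"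
        using d1(2)[of ?q] small[OF that] tc by (simp add: dist_norm add.assoc)
      then have f': "(f has_derivative frechet_derivative f (at ?q)) (at ?q)"
        by (simp add: frechet_derivative_works)
      have "((\<lambda>s. p + s *\<^sub>R a + r *\<^sub>R b) has_derivative (\<lambda>x. x *\<^sub>R a)) (at s within {0..t})"
        by (auto intro!: derivative_eq_intros)
      from has_derivative_compose[OF this f']
      show ?thesis
        using linear_cmul[OF has_derivative_linear[OF f']] by simp
    qed
    \<comment> \<open>\<open>\<phi> t - \<phi> 0\<close> is the second difference minus \<open>t\<^sup>2 A b\<close>, and the derivative of \<open>\<phi>\<close> is \<open>o(t)\<close>:
      the terms \<open>A (s a)\<close> of the two linearizations at \<open>p\<close> cancel.\<close>
    define \<phi> where "\<phi> s = f (p + s *\<^sub>R a + t *\<^sub>R b) - f (p + s *\<^sub>R a) - s *\<^sub>R t *\<^sub>R A b" for s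
    have \<phi>': "(\<phi> has_derivative (\<lambda>x. x *\<^sub>R (?h (p + s *\<^sub>R a + t *\<^sub>R b) - ?h (p + s *\<^sub>R a) - t *\<^sub>R A b)))
                (at s within {0..t})" if "s \<in> {0..t}" for s
      unfolding \<phi>_def using that t der[of s t] der[of s 0]
      by (auto intro!: derivative_eq_intros simp: algebra_simps)
    have on: "onorm (\<lambda>x. x *\<^sub>R (?h (p + s *\<^sub>R a + t *\<^sub>R b) - ?h (p + s *\<^sub>R a) - t *\<^sub>R A b))
                \<le> 2 * (e * (t * c))" if "s \<in> {0..t}" for s
    proof -
      have "?h (p + s *\<^sub>R a + t *\<^sub>R b) - ?h (p + s *\<^sub>R a) - t *\<^sub>R A b
          = (?h (p + s *\<^sub>R a + t *\<^sub>R b) - ?h p - A (s *\<^sub>R a + t *\<^sub>R b))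
          - (?h (p + s *\<^sub>R a + 0 *\<^sub>R b) - ?h p - A (s *\<^sub>R a + 0 *\<^sub>R b))"
        by (simp add: A.add A.scaleR)
      also have "norm \<dots> \<le> e * (t * c) + e * (t * c)"
        using that t by (intro norm_triangle_le_diff add_mono est) auto
      finally have *: "norm (?h (p + s *\<^sub>R a + t *\<^sub>R b) - ?h (p + s *\<^sub>R a) - t *\<^sub>R A b)
                      \<le> 2 * (e * (t * c))"
        by (simp only: mult_2)
      show ?thesis
      proof (rule onorm_bound)
        show "0 \<le> 2 * (e * (t * c))"
          using e t c by simp
        show "norm (x *\<^sub>R (?h (p + s *\<^sub>R a + t *\<^sub>R b) - ?h (p + s *\<^sub>R a) - t *\<^sub>R A b))
                \<le> 2 * (e * (t * c)) * norm x" for x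
          using mult_left_mono[OF *, of "\<bar>x\<bar>"] by (simp add: mult.commute)
      qed
    qed
    have "norm (\<phi> t - \<phi> 0) \<le> 2 * (e * (t * c)) * norm (t - 0)"
      by (rule differentiable_bound[OF _ \<phi>' on]) (use t in auto)
    also have "\<dots> = \<epsilon> / 2 * t\<^sup>2"
      using t c by (simp add: e_def power2_eq_square)
    finally have "norm (\<phi> t - \<phi> 0) \<le> \<epsilon> / 2 * t\<^sup>2" .
    moreover have "(f (p + t *\<^sub>R a + t *\<^sub>R b) - f (p + t *\<^sub>R a) - f (p + t *\<^sub>R b) + f p) /\<^sub>R t\<^sup>2 - A b
                     = (\<phi> t - \<phi> 0) /\<^sub>R t\<^sup>2"
      using t by (simp add: \<phi>_def power2_eq_square algebra_simps)
    moreover have "norm ((\<phi> t - \<phi> 0) /\<^sub>R t\<^sup>2) = norm (\<phi> t - \<phi> 0) / t\<^sup>2"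
      by (simp add: divide_inverse mult.commute)
    ultimately have "dist ((f (p + t *\<^sub>R a + t *\<^sub>R b) - f (p + t *\<^sub>R a) - f (p + t *\<^sub>R b) + f p) /\<^sub>R t\<^sup>2)
                       (A b) \<le> \<epsilon> / 2"
      using t by (simp only: dist_norm) (simp add: pos_divide_le_eq)
    then show ?thesis
      using \<open>\<epsilon> > 0\<close> by simp
  qed
  show "\<forall>\<^sub>F t in at_right 0.
          dist ((f (p + t *\<^sub>R a + t *\<^sub>R b) - f (p + t *\<^sub>R a) - f (p + t *\<^sub>R b) + f p) /\<^sub>R t\<^sup>2) (A b) < \<epsilon>"
    unfolding eventually_at_right_field using d bound by (intro exI[of _ d]) blast
qed

lemma frechet_derivative_commute:
  fixes f :: "'a::real_normed_vector \<Rightarrow> 'b::real_normed_vector"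
  assumes diff: "\<forall>\<^sub>F q in nhds p. f differentiable (at q)"
    and a: "(\<lambda>q. frechet_derivative f (at q) a) differentiable (at p)"
    and b: "(\<lambda>q. frechet_derivative f (at q) b) differentiable (at p)"
  shows "frechet_derivative (\<lambda>q. frechet_derivative f (at q) a) (at p) b
       = frechet_derivative (\<lambda>q. frechet_derivative f (at q) b) (at p) a"
proof (rule tendsto_unique[OF _ second_difference_tendsto[OF diff]])
  show "((\<lambda>t. (f (p + t *\<^sub>R a + t *\<^sub>R b) - f (p + t *\<^sub>R a) - f (p + t *\<^sub>R b) + f p) /\<^sub>R t\<^sup>2)
          \<longlongrightarrow> frechet_derivative (\<lambda>q. frechet_derivative f (at q) b) (at p) a) (at_right 0)"
    using second_difference_tendsto[OF diff b[unfolded frechet_derivative_works], of a]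
    by (simp add: algebra_simps)
qed (use a in \<open>simp_all add: frechet_derivative_works\<close>)

lemma smooth_on_differentiable:
  assumes "smooth_on D f" "q \<in> D"
  shows "f differentiable (at q)"
    and "(\<lambda>q. frechet_derivative f (at q) a) differentiable (at q)"
proof -
  have "Ck_on (Suc (Suc 0)) D f"
    using assms(1) by (simp only: smooth_on_def)
  then have "(\<forall>q\<in>D. f differentiable (at q)) \<and>
      (\<forall>a. \<forall>q\<in>D. (\<lambda>q. frechet_derivative f (at q) a) differentiable (at q))"
    unfolding Ck_on.simps by blast
  then show "f differentiable (at q)" "(\<lambda>q. frechet_derivative f (at q) a) differentiable (at q)"
    using assms(2) by blast+
qed

lemma second_derivative_commute:
  assumes "regular_surface D z" "p \<in> D"
  shows "second_derivative z p a b = second_derivative z p b a"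
proof -
  have z: "smooth_on D z" and "open D"
    using assms(1) by (auto simp: regular_surface_def)
  have "\<forall>\<^sub>F q in nhds p. z differentiable (at q)"
    using eventually_nhds_in_open[OF \<open>open D\<close> assms(2)]
    by (rule eventually_mono) (rule smooth_on_differentiable(1)[OF z])
  then show ?thesis
    unfolding second_derivative_def
    by (rule frechet_derivative_commute) (rule smooth_on_differentiable(2)[OF z assms(2)])+
qed

section \<open>The second fundamental tensor in coordinates\<close>

text \<open>A vector and its normal part differ by a tangent vector. Most of the proof establishes that
  the description of the normal part determines a unique vector.\<close>

lemma inner_normal_part:
  assumes "n \<in> normal_space z p"
  shows "normal_part z p x \<bullet> n = x \<bullet> n"
proof -
  let ?T = "tangent_space z p" and ?N = "normal_space z p"
  have orth: "a \<bullet> w = 0" if "a \<in> ?T" "w \<in> ?N" for a w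
    using that by (auto simp: normal_space_def orthogonal_comp_def orthogonal_def)
  have sub: "subspace ?T" "subspace ?N"
    by (simp_all add: tangent_space_def normal_space_def subspace_orthogonal_comp)
  have "\<exists>!w. w \<in> ?N \<and> x - w \<in> ?T"
  proof (rule ex_ex1I)
    obtain y w where "y \<in> span ?T" "\<And>v. v \<in> span ?T \<Longrightarrow> orthogonal w v" "x = y + w"
      using orthogonal_subspace_decomp_exists by blast
    moreover have "span ?T = ?T"
      using sub by (simp add: span_eq_iff)
    ultimately show "\<exists>w. w \<in> ?N \<and> x - w \<in> ?T"
      by (intro exI[of _ w]) (auto simp: normal_space_def orthogonal_comp_def orthogonal_commute)
  next
    fix w w'
    assume w: "w \<in> ?N \<and> x - w \<in> ?T" "w' \<in> ?N \<and> x - w' \<in> ?T"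
    then have "w - w' \<in> ?N"
      using sub(2) by (simp add: subspace_diff)
    moreover have "w - w' \<in> ?T"
      using w subspace_diff[OF sub(1), of "x - w'" "x - w"] by simp
    ultimately have "(w - w') \<bullet> (w - w') = 0"
      using orth by blast
    then show "w = w'"
      by simp
  qed
  then have "normal_part z p x \<in> ?N \<and> x - normal_part z p x \<in> ?T"
    unfolding normal_part_def by (rule theI')
  then have "(x - normal_part z p x) \<bullet> n = 0"
    using orth assms by blast
  then show ?thesis
    by (simp add: inner_diff_left)
qed

lemma frechet_derivative_eq_tangent_vector:
  assumes "regular_surface D z" "p \<in> D"
  shows "frechet_derivative z (at p) (l, m) = tangent_vector z p l m"
proof -
  have "z differentiable (at p)"
    using assms by (auto simp: regular_surface_def intro: smooth_on_differentiable(1))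
  then have lin: "linear (frechet_derivative z (at p))"
    by (rule linear_frechet_derivative)
  have "(l, m) = l *\<^sub>R (1, 0) + m *\<^sub>R (0, 1)"
    by simp
  then show ?thesis
    unfolding tangent_vector_def partial_u_def partial_v_def
    by (simp only: linear_add[OF lin] linear_cmul[OF lin])
qed

text \<open>Paired with a normal vector, \<open>\<sigma>\<close> becomes the Hessian of \<open>z\<close>.\<close>

lemma inner_sigma:
  assumes "regular_surface D z" "p \<in> D" "n \<in> normal_space z p"
  shows "sigma z p (tangent_vector z p l m) (tangent_vector z p l' m') \<bullet> n
       = second_derivative z p (l, m) (l', m') \<bullet> n"
proof -
  have "inj (frechet_derivative z (at p))"
    using assms by (auto simp: regular_surface_def)
  then show ?thesis
    using assms
    by (simp add: sigma_def inner_normal_part inv_f_f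
        flip: frechet_derivative_eq_tangent_vector[OF assms(1,2)])
qed

lemma second_derivative_expand_left:
  assumes "regular_surface D z" "p \<in> D"
  shows "second_derivative z p (l, m) b
       = l *\<^sub>R second_derivative z p (1, 0) b + m *\<^sub>R second_derivative z p (0, 1) b"
proof -
  let ?h = "\<lambda>q. frechet_derivative z (at q) b"
  have "smooth_on D z"
    using assms(1) by (simp add: regular_surface_def)
  then have "?h differentiable (at p)"
    using assms(2) by (rule smooth_on_differentiable(2))
  then have lin: "linear (frechet_derivative ?h (at p))"
    by (rule linear_frechet_derivative)
  have "frechet_derivative ?h (at p) (l *\<^sub>R (1, 0) + m *\<^sub>R (0, 1))
      = l *\<^sub>R frechet_derivative ?h (at p) (1, 0) + m *\<^sub>R frechet_derivative ?h (at p) (0, 1)"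
    by (simp only: linear_add[OF lin] linear_cmul[OF lin])
  then show ?thesis
    by (simp add: second_derivative_def)
qed

lemma partials_eq_tangent_vector:
  "partial_u z p = tangent_vector z p 1 0" "partial_v z p = tangent_vector z p 0 1"
  by (simp_all add: tangent_vector_def)

lemma inner_sigma_commute:
  assumes "regular_surface D z" "p \<in> D" "n \<in> normal_space z p"
  shows "sigma z p (partial_v z p) (partial_u z p) \<bullet> n
       = sigma z p (partial_u z p) (partial_v z p) \<bullet> n"
  using assms
  by (simp add: partials_eq_tangent_vector inner_sigma second_derivative_commute[of D z p "(0, 1)" "(1, 0)"])

lemma inner_sigma_tangent:
  assumes "regular_surface D z" "p \<in> D" "n \<in> normal_space z p"
  shows "sigma_tangent z p l m (tangent_vector z p l' m') \<bullet> n
       = (l * (sigma z p (partial_u z p) (tangent_vector z p l' m') \<bullet> n)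
          + m * (sigma z p (partial_v z p) (tangent_vector z p l' m') \<bullet> n))
         / sqrt (first_form z p l m)"
proof -
  let ?r = "1 / sqrt (first_form z p l m)"
  have "?r *\<^sub>R tangent_vector z p l m = tangent_vector z p (?r * l) (?r * m)"
    by (simp add: tangent_vector_def scaleR_add_right)
  then show ?thesis
    unfolding sigma_tangent_def partials_eq_tangent_vector
    using assms second_derivative_expand_left[OF assms(1,2), of "?r * l" "?r * m"]
    by (simp add: inner_sigma inner_add_left add_divide_distrib)
qed

lemma first_form_eq_norm: "first_form z p l m = (norm (tangent_vector z p l m))\<^sup>2"
  unfolding power2_norm_eq_inner first_form_def coeff_E_def coeff_F_def coeff_G_def tangent_vector_def
  by (simp add: inner_add_left inner_add_right
      inner_commute[of "partial_v z p" "partial_u z p"] power2_eq_square algebra_simps)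

section \<open>Conjugacy\<close>

text \<open>The mixed terms \<open>\<lambda>\<^sub>1\<mu>\<^sub>2\<close> and \<open>\<lambda>\<^sub>2\<mu>\<^sub>1\<close> come from different summands of \<open>\<zeta>\<close>; the factor 2
  in the definitions of \<open>L\<close> and \<open>N\<close> arises because both summands of \<open>\<zeta>\<close> contribute equally to the corresponding terms.\<close>

lemma zeta_eq_polar:
  assumes "regular_surface D z" "oriented_normal_frame D z e1 e2" "p \<in> D"
  shows "zeta z e1 e2 p l1 m1 l2 m2
       = second_form_polar z e1 e2 p l1 m1 l2 m2
         / (sqrt (first_form z p l1 m1) * sqrt (first_form z p l2 m2))"
proof -
  have n: "e1 p \<in> normal_space z p" "e2 p \<in> normal_space z p"
    using assms by (auto simp: oriented_normal_frame_def)
  note u = inner_sigma_tangent[OF assms(1,3), of _ _ _ 1 0, folded partials_eq_tangent_vector]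
  note v = inner_sigma_tangent[OF assms(1,3), of _ _ _ 0 1, folded partials_eq_tangent_vector]
  note sym = inner_sigma_commute[OF assms(1,3)]
  let ?S = "oriented_area (e1 p) (e2 p)"
    and ?r = "\<lambda>l m. sqrt (first_form z p l m)"
    and ?uu = "sigma z p (partial_u z p) (partial_u z p)"
    and ?uv = "sigma z p (partial_u z p) (partial_v z p)"
    and ?vv = "sigma z p (partial_v z p) (partial_v z p)"
  have area: "?S (sigma_tangent z p l m (partial_u z p)) (sigma_tangent z p l' m' (partial_v z p))
      = (l * l' * ?S ?uu ?uv + l * m' * ?S ?uu ?vv + m * m' * ?S ?uv ?vv) / (?r l m * ?r l' m')"
    for l m l' m'
    unfolding oriented_area_def u[OF n(1)] u[OF n(2)] v[OF n(1)] v[OF n(2)] sym[OF n(1)] sym[OF n(2)]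
      times_divide_times_eq diff_divide_distrib[symmetric]
    by (rule arg_cong[where f = "\<lambda>x. x / _"]) algebra
  have polar: "second_form_polar z e1 e2 p l1 m1 l2 m2
      = (2 * (l1 * l2) * ?S ?uu ?uv + (l1 * m2 + m1 * l2) * ?S ?uu ?vv
          + 2 * (m1 * m2) * ?S ?uv ?vv) / coeff_W z p"
    unfolding second_form_polar_def coeff_L_def coeff_M_def coeff_N_def
    by (simp add: add_divide_distrib mult_ac)
  show ?thesis
    unfolding zeta_def area polar mult.commute[of "?r l2 m2"] add_divide_distrib[symmetric]
      divide_divide_eq_left mult.commute[of "coeff_W z p"]
    by (rule arg_cong[where f = "\<lambda>x. x / _"]) algebra
qed

lemma zeta_eq_0_iff:
  assumes "regular_surface D z" "oriented_normal_frame D z e1 e2" "p \<in> D"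
    and "tangent_determined_by z p g1 l1 m1" "tangent_determined_by z p g2 l2 m2"
  shows "zeta z e1 e2 p l1 m1 l2 m2 = 0 \<longleftrightarrow> second_form_polar z e1 e2 p l1 m1 l2 m2 = 0"
  using assms(4,5)
  by (simp add: zeta_eq_polar[OF assms(1-3)] first_form_eq_norm tangent_determined_by_def)

theorem mainTheorem2:
  fixes D :: "(real \<times> real) set"
    and z e1 e2 :: "real \<times> real \<Rightarrow> real^4"
    and p :: "real \<times> real"
    and g1 g2 :: "(real^4) set"
    and l1 m1 l2 m2 :: real
  assumes "regular_surface D z"
    and "oriented_normal_frame D z e1 e2"
    and "\<And>q. q \<in> D \<Longrightarrow> \<not> flat_point z e1 e2 q"
    and "p \<in> D"
    and "tangent_determined_by z p g1 l1 m1"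
    and "tangent_determined_by z p g2 l2 m2"
  shows "(zeta z e1 e2 p l1 m1 l2 m2 = 0 \<longleftrightarrow>
            coeff_L z e1 e2 p * l1 * l2 + coeff_M z e1 e2 p * (l1 * m2 + m1 * l2)
            + coeff_N z e1 e2 p * m1 * m2 = 0)
       \<and> (zeta_conjugate z e1 e2 p g1 g2 \<longleftrightarrow> second_form_conjugate z e1 e2 p g1 g2)"
proof (intro conjI)
  note eq0 = zeta_eq_0_iff[OF assms(1,2,4)]
  show "zeta z e1 e2 p l1 m1 l2 m2 = 0 \<longleftrightarrow>
            coeff_L z e1 e2 p * l1 * l2 + coeff_M z e1 e2 p * (l1 * m2 + m1 * l2)
            + coeff_N z e1 e2 p * m1 * m2 = 0"
    using eq0[OF assms(5,6)] by (simp only: second_form_polar_def)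
  show "zeta_conjugate z e1 e2 p g1 g2 \<longleftrightarrow> second_form_conjugate z e1 e2 p g1 g2"
    unfolding zeta_conjugate_def second_form_conjugate_def using eq0 by blast
qed

end
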